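(* Let $f\in C_B[0,\infty)$, $x\ge\frac12$ and $n\in\mathbb{N}$. Then $$|K_n(f;x)-f(x)|\le 2\,\omega(f;\delta_{n,x}),$$ where $$\delta_{n,x}=\sqrt{K_n((t-x)^2;x)}=\sqrt{\left(1+2\mu\frac{e_\mu(-nr_n(x))}{e_\mu(nr_n(x))}\right)\frac{x}{n}-\frac1{n^2}\left(\frac5{12}+\mu\frac{e_\mu(-nr_n(x))}{e_\mu(nr_n(x))}\right)}.$$
   Context: Fix a real number $\mu\ge 0$. Let $\theta_k=0$ for even integers $k\ge 0$ and $\theta_k=1$ for odd $k$. For integers $k\ge 0$ set $$\gamma_\mu(2k)=\frac{2^{2k}k!\,\Gamma(k+\mu+\frac12)}{\Gamma(\mu+\frac12)},\qquad \gamma_\mu(2k+1)=\frac{2^{2k+1}k!\,\Gamma(k+\mu+\frac32)}{\Gamma(\mu+\frac12)},$$ so that $\gamma_\mu(k+1)=(k+1+2\mu\theta_{k+1})\gamma_\mu(k)$, and let $e_\mu(x)=\sum_{k=0}^\infty \frac{x^k}{\gamma_\mu(k)}$ for real $x$. For $n\in\mathbb{N}=\{1,2,\dots\}$ and $x\ge\frac12$ let $r_n(x)=x-\frac1{2n}$ and define $$K_n(f;x)=\frac{n}{e_\mu(nr_n(x))}\sum_{k=0}^\infty\frac{(nr_n(x))^k}{\gamma_\mu(k)}\int_{\frac{k+2\mu\theta_k}{n}}^{\frac{k+1+2\mu\theta_k}{n}}f(t)\,dt .$$ $K_n((t-x)^2;x)$ denotes the operator applied to the function $t\mapsto (t-x)^2$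 (with $x$ fixed), evaluated at $x$. $C_B[0,\infty)$ is the space of bounded continuous real-valued functions on $[0,\infty)$. The modulus of continuity is $\omega(f;\delta)=\sup\{|f(t)-f(s)|: s,t\in[0,\infty),\ |t-s|\le\delta\}$ for $\delta>0$. *)

theory Defs
  imports "HOL-Analysis.Analysis"
begin

definition dunkl_theta :: "nat \<Rightarrow> real" where
  "dunkl_theta k = (if even k then 0 else 1)"

(* For k = 2j the coefficient is 2^(2j) j! Gamma(j + mu + 1/2) / Gamma(mu + 1/2); for k = 2j + 1 it is
   2^(2j+1) j! Gamma(j + mu + 3/2) / Gamma(mu + 1/2). In both cases j = k div 2. *)
definition dunkl_gamma :: "real \<Rightarrow> nat \<Rightarrow> real" where
  "dunkl_gamma \<mu> k =
     (if even k
      then 2 ^ k * fact (k div 2) * Gamma (real (k div 2) + \<mu> + 1 / 2) / Gamma (\<mu> + 1 / 2)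
      else 2 ^ k * fact (k div 2) * Gamma (real (k div 2) + \<mu> + 3 / 2) / Gamma (\<mu> + 1 / 2))"

definition dunkl_exp :: "real \<Rightarrow> real \<Rightarrow> real" where
  "dunkl_exp \<mu> x = (\<Sum>k. x ^ k / dunkl_gamma \<mu> k)"

definition r_shift :: "nat \<Rightarrow> real \<Rightarrow> real" where
  "r_shift n x = x - 1 / (2 * real n)"

definition dunkl_kantorovich :: "real \<Rightarrow> nat \<Rightarrow> (real \<Rightarrow> real) \<Rightarrow> real \<Rightarrow> real" where
  "dunkl_kantorovich \<mu> n f x =
     real n / dunkl_exp \<mu> (real n * r_shift n x) *
     (\<Sum>k. (real n * r_shift n x) ^ k / dunkl_gamma \<mu> k *
        integral {(real k + 2 * \<mu> * dunkl_theta k) / real n ..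
                  (real k + 1 + 2 * \<mu> * dunkl_theta k) / real n} f)"

(* Functions on [0, \<infinity>) are represented by total functions; their values at negative arguments
   play no role in the following definitions. *)
definition C_B :: "(real \<Rightarrow> real) set" where
  "C_B = {f. continuous_on {0..} f \<and> bounded (f ` {0..})}"

definition modulus_of_continuity :: "(real \<Rightarrow> real) \<Rightarrow> real \<Rightarrow> real" where
  "modulus_of_continuity f \<delta> = Sup {\<bar>f t - f s\<bar> | t s. t \<in> {0..} \<and> s \<in> {0..} \<and> \<bar>t - s\<bar> \<le> \<delta>}"

definition dunkl_delta :: "real \<Rightarrow> nat \<Rightarrow> real \<Rightarrow> real" where
  "dunkl_delta \<mu> n x = sqrt (dunkl_kantorovich \<mu> n (\<lambda>t. (t - x)\<^sup>2) x)"

end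

theory Submission
  imports Defs
begin

text \<open>
  The operator is an average: with \<open>y = n r\<^sub>n(x)\<close>, the weights \<open>y ^ k / \<gamma>\<^sub>\<mu>(k)\<close>, divided by
  \<open>e\<^sub>\<mu>(y)\<close>, form a probability distribution (\<open>y \<ge> 0\<close> because \<open>x \<ge> 1/2\<close>), and \<open>n\<close> times the
  integral is the mean of \<open>f\<close> over an interval of length \<open>1/n\<close> that starts at \<open>h\<^sub>k / n\<close>, where
  \<open>h\<^sub>k = k + 2\<mu>\<theta>\<^sub>k\<close>.

  The closed form of \<open>\<delta>\<close> comes from the recurrence \<open>\<gamma>\<^sub>\<mu>(k+1) = h\<^sub>k\<^sub>+\<^sub>1 \<gamma>\<^sub>\<mu>(k)\<close>: multiplying a weight
  by \<open>h\<^sub>k\<close> shifts the series by one index and takes out a factor \<open>y\<close>.  Doing this once gives the mean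
  of \<open>h\<close>, namely \<open>y\<close>.  Doing it twice leaves a factor \<open>h\<^sub>k\<^sub>+\<^sub>1 = h\<^sub>k + 1 + 2\<mu>(-1)\<^sup>k\<close>, and its
  alternating part is what brings in \<open>e\<^sub>\<mu>(-y)\<close>.  The shift \<open>1/(2n)\<close> in \<open>r\<^sub>n\<close> puts \<open>y/n\<close> half an
  interval to the left of \<open>x\<close>, so that \<open>n\<^sup>2\<close> times the mean of \<open>(t - x)\<^sup>2\<close> over the \<open>k\<close>-th interval is
  \<open>(h\<^sub>k - y)\<^sup>2 + 1/12\<close>, with no linear term.

  For the estimate, the modulus of continuity gives
  \<open>\<bar>f t - f x\<bar> \<le> (1 + (t - x)\<^sup>2 / \<delta>\<^sup>2) \<omega>(f; \<delta>)\<close> for every \<open>\<delta> > 0\<close>.  With the quadratic bound in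
  place of the usual \<open>1 + \<bar>t - x\<bar> / \<delta>\<close>, averaging needs no Cauchy--Schwarz inequality: if \<open>\<delta>\<^sup>2\<close> is
  the mean of \<open>(t - x)\<^sup>2\<close>, the average of the right-hand side is exactly \<open>2 \<omega>(f; \<delta>)\<close>.
\<close>

section \<open>The Dunkl coefficients\<close>

definition dunkl_node :: "real \<Rightarrow> nat \<Rightarrow> real" where
  "dunkl_node \<mu> k = real k + 2 * \<mu> * dunkl_theta k"

lemma dunkl_node_0 [simp]: "dunkl_node \<mu> 0 = 0"
  by (simp add: dunkl_node_def dunkl_theta_def)

lemma dunkl_node_ge:
  assumes "\<mu> \<ge> 0"
  shows "dunkl_node \<mu> k \<ge> real k"
  using assms by (simp add: dunkl_node_def dunkl_theta_def)

lemma dunkl_node_Suc: "dunkl_node \<mu> (Suc k) = dunkl_node \<mu> k + 1 + 2 * \<mu> * (-1) ^ k"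
  by (simp add: dunkl_node_def dunkl_theta_def)

lemma dunkl_gamma_0:
  assumes "\<mu> \<ge> 0"
  shows "dunkl_gamma \<mu> 0 = 1"
proof -
  have "Gamma (\<mu> + 1 / 2) > 0"
    using assms by (intro Gamma_real_pos) auto
  then show ?thesis by (simp add: dunkl_gamma_def)
qed

lemma dunkl_gamma_Suc:
  assumes "\<mu> \<ge> 0"
  shows "dunkl_gamma \<mu> (Suc k) = dunkl_node \<mu> (Suc k) * dunkl_gamma \<mu> k"
proof (cases "even k")
  case True
  then obtain j where k: "k = 2 * j" by blast
  have "Gamma (real j + \<mu> + 1 / 2 + 1) = (real j + \<mu> + 1 / 2) * Gamma (real j + \<mu> + 1 / 2)"
    using assms by (intro Gamma_plus1) (auto elim!: nonpos_Ints_cases)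
  then have "Gamma (real j + \<mu> + 3 / 2) = (real j + \<mu> + 1 / 2) * Gamma (real j + \<mu> + 1 / 2)"
    by (simp add: add.assoc)
  then show ?thesis
    by (simp add: k dunkl_gamma_def dunkl_node_def dunkl_theta_def)
next
  case False
  then obtain j where k: "k = 2 * j + 1" by (blast elim: oddE)
  have "real (Suc j) + \<mu> + 1 / 2 = real j + \<mu> + 3 / 2" by simp
  then show ?thesis
    by (simp add: k dunkl_gamma_def dunkl_node_def dunkl_theta_def field_simps)
qed

lemma dunkl_gamma_ge_fact:
  assumes "\<mu> \<ge> 0"
  shows "dunkl_gamma \<mu> k \<ge> fact k"
proof (induction k)
  case (Suc k)
  have "fact (Suc k) = real (Suc k) * fact k" by simp
  also have "\<dots> \<le> dunkl_node \<mu> (Suc k) * dunkl_gamma \<mu> k"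
    using Suc dunkl_node_ge[OF assms, of "Suc k"] by (intro mult_mono) auto
  finally show ?case by (simp add: dunkl_gamma_Suc[OF assms])
qed (simp add: dunkl_gamma_0[OF assms])

lemma dunkl_gamma_pos:
  assumes "\<mu> \<ge> 0"
  shows "dunkl_gamma \<mu> k > 0"
  using dunkl_gamma_ge_fact[OF assms, of k] by (smt (verit) fact_gt_zero)

section \<open>Moments of the weights\<close>

lemma dunkl_exp_sums:
  assumes "\<mu> \<ge> 0"
  shows "(\<lambda>k. y ^ k / dunkl_gamma \<mu> k) sums dunkl_exp \<mu> y"
proof -
  have "summable (\<lambda>k. y ^ k / dunkl_gamma \<mu> k)"
  proof (rule summable_comparison_test')
    show "summable (\<lambda>k. inverse (fact k) * \<bar>y\<bar> ^ k)" by (rule summable_exp)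
    show "norm (y ^ k / dunkl_gamma \<mu> k) \<le> inverse (fact k) * \<bar>y\<bar> ^ k" if "k \<ge> 0" for k
    proof -
      have "\<bar>y\<bar> ^ k / dunkl_gamma \<mu> k \<le> \<bar>y\<bar> ^ k / fact k"
        using dunkl_gamma_ge_fact[OF assms, of k] dunkl_gamma_pos[OF assms, of k]
        by (intro divide_left_mono) auto
      then show ?thesis
        using dunkl_gamma_pos[OF assms, of k]
        by (simp add: abs_mult power_abs divide_inverse mult.commute)
    qed
  qed
  then show ?thesis by (simp add: dunkl_exp_def summable_sums)
qed

lemma dunkl_exp_pos:
  assumes "\<mu> \<ge> 0" "y \<ge> 0"
  shows "dunkl_exp \<mu> y > 0"
proof -
  have "(\<Sum>k<1. y ^ k / dunkl_gamma \<mu> k) \<le> dunkl_exp \<mu> y"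
    unfolding dunkl_exp_def
  proof (rule sum_le_suminf)
    show "summable (\<lambda>k. y ^ k / dunkl_gamma \<mu> k)"
      using dunkl_exp_sums[OF assms(1)] by (rule sums_summable)
    show "0 \<le> y ^ k / dunkl_gamma \<mu> k" for k
      using assms dunkl_gamma_pos[OF assms(1), of k] by simp
  qed simp
  then show ?thesis by (simp add: dunkl_gamma_0[OF assms(1)])
qed

text \<open>
  The recurrence for \<open>\<gamma>\<^sub>\<mu>\<close> cancels one factor \<open>h\<^sub>k\<close> against the denominator, and the term for
  \<open>k = 0\<close> vanishes because \<open>h\<^sub>0 = 0\<close>.  The free factor \<open>c\<close> lets the same shift serve for the
  first and the second moment.
\<close>

lemma dunkl_node_shift_sums:
  assumes "\<mu> \<ge> 0" and "(\<lambda>k. y ^ k / dunkl_gamma \<mu> k * c (Suc k)) sums s"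
  shows "(\<lambda>k. y ^ k / dunkl_gamma \<mu> k * (dunkl_node \<mu> k * c k)) sums (y * s)"
proof -
  let ?F = "\<lambda>k. y ^ k / dunkl_gamma \<mu> k * (dunkl_node \<mu> k * c k)"
  have "?F (Suc k) = y * (y ^ k / dunkl_gamma \<mu> k * c (Suc k))" for k
    using dunkl_node_ge[OF assms(1), of "Suc k"] by (simp add: dunkl_gamma_Suc[OF assms(1)])
  then have "(\<lambda>k. ?F (Suc k)) sums (y * s)"
    using sums_mult[OF assms(2), of y] by (simp only:)
  then have "?F sums (y * s + ?F 0)" by (rule sums_Suc)
  then show ?thesis by simp
qed

lemma dunkl_first_moment_sums:
  assumes "\<mu> \<ge> 0"
  shows "(\<lambda>k. y ^ k / dunkl_gamma \<mu> k * dunkl_node \<mu> k) sums (y * dunkl_exp \<mu> y)"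
  using dunkl_node_shift_sums[OF assms, of y "\<lambda>_. 1"] dunkl_exp_sums[OF assms, of y] by simp

lemma dunkl_second_moment_sums:
  assumes "\<mu> \<ge> 0"
  shows "(\<lambda>k. y ^ k / dunkl_gamma \<mu> k * (dunkl_node \<mu> k)\<^sup>2) sums
           (y * (y * dunkl_exp \<mu> y + dunkl_exp \<mu> y + 2 * \<mu> * dunkl_exp \<mu> (- y)))"
  unfolding power2_eq_square
proof (rule dunkl_node_shift_sums[OF assms])
  have "(\<lambda>k. y ^ k / dunkl_gamma \<mu> k * dunkl_node \<mu> k + y ^ k / dunkl_gamma \<mu> k
            + 2 * \<mu> * ((- y) ^ k / dunkl_gamma \<mu> k))
          sums (y * dunkl_exp \<mu> y + dunkl_exp \<mu> y + 2 * \<mu> * dunkl_exp \<mu> (- y))"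
    by (intro sums_add sums_mult dunkl_first_moment_sums dunkl_exp_sums assms)
  moreover have "y ^ k / dunkl_gamma \<mu> k * dunkl_node \<mu> k + y ^ k / dunkl_gamma \<mu> k
                   + 2 * \<mu> * ((- y) ^ k / dunkl_gamma \<mu> k)
                 = y ^ k / dunkl_gamma \<mu> k * dunkl_node \<mu> (Suc k)" for k
    by (simp add: dunkl_node_Suc power_minus[of y] algebra_simps)
  ultimately show "(\<lambda>k. y ^ k / dunkl_gamma \<mu> k * dunkl_node \<mu> (Suc k)) sums
      (y * dunkl_exp \<mu> y + dunkl_exp \<mu> y + 2 * \<mu> * dunkl_exp \<mu> (- y))"
    by simp
qed

text \<open>
  The square terms \<open>y\<^sup>2\<close> of the second moment cancel, so the variance grows only linearly in \<open>y\<close>;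
  this is why \<open>\<delta>\<^sup>2\<close> is of order \<open>x / n\<close>.
\<close>

lemma dunkl_variance_sums:
  assumes "\<mu> \<ge> 0"
  shows "(\<lambda>k. y ^ k / dunkl_gamma \<mu> k * (dunkl_node \<mu> k - y)\<^sup>2) sums
           (y * (dunkl_exp \<mu> y + 2 * \<mu> * dunkl_exp \<mu> (- y)))"
proof -
  let ?w = "\<lambda>k. y ^ k / dunkl_gamma \<mu> k"
  have "(\<lambda>k. ?w k * (dunkl_node \<mu> k)\<^sup>2 - 2 * y * (?w k * dunkl_node \<mu> k) + y\<^sup>2 * ?w k) sums
          (y * (y * dunkl_exp \<mu> y + dunkl_exp \<mu> y + 2 * \<mu> * dunkl_exp \<mu> (- y))
           - 2 * y * (y * dunkl_exp \<mu> y) + y\<^sup>2 * dunkl_exp \<mu> y)"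
    by (intro sums_add sums_diff sums_mult dunkl_first_moment_sums dunkl_second_moment_sums
        dunkl_exp_sums assms)
  moreover have "?w k * (dunkl_node \<mu> k)\<^sup>2 - 2 * y * (?w k * dunkl_node \<mu> k) + y\<^sup>2 * ?w k
                 = ?w k * (dunkl_node \<mu> k - y)\<^sup>2" for k
    by (simp add: power2_diff ring_distribs mult_ac)
  moreover have "y * (y * dunkl_exp \<mu> y + dunkl_exp \<mu> y + 2 * \<mu> * dunkl_exp \<mu> (- y))
           - 2 * y * (y * dunkl_exp \<mu> y) + y\<^sup>2 * dunkl_exp \<mu> y
         = y * (dunkl_exp \<mu> y + 2 * \<mu> * dunkl_exp \<mu> (- y))"
    by (simp add: power2_eq_square algebra_simps)
  ultimately show ?thesis by simp
qed

section \<open>The modulus of continuity\<close>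

lemma modulus_of_continuity_upper:
  assumes "f \<in> C_B" "t \<ge> 0" "s \<ge> 0" "\<bar>t - s\<bar> \<le> \<delta>"
  shows "\<bar>f t - f s\<bar> \<le> modulus_of_continuity f \<delta>"
  unfolding modulus_of_continuity_def
proof (rule cSup_upper)
  show "\<bar>f t - f s\<bar> \<in> {\<bar>f t - f s\<bar> |t s. t \<in> {0..} \<and> s \<in> {0..} \<and> \<bar>t - s\<bar> \<le> \<delta>}"
    using assms by auto
  obtain B where B: "\<And>u. u \<ge> 0 \<Longrightarrow> \<bar>f u\<bar> \<le> B"
    using assms(1) by (auto simp: C_B_def bounded_iff)
  have "\<bar>f u - f v\<bar> \<le> 2 * B" if "u \<ge> 0" "v \<ge> 0" for u v
    using B[OF that(1)] B[OF that(2)] by linarith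
  then show "bdd_above {\<bar>f t - f s\<bar> |t s. t \<in> {0..} \<and> s \<in> {0..} \<and> \<bar>t - s\<bar> \<le> \<delta>}"
    by (intro bdd_aboveI[of _ "2 * B"]) auto
qed

lemma modulus_of_continuity_nonneg:
  assumes "f \<in> C_B" "\<delta> \<ge> 0"
  shows "modulus_of_continuity f \<delta> \<ge> 0"
  using modulus_of_continuity_upper[of f 0 0 \<delta>] assms by simp

text \<open>A distance of at most \<open>m \<delta>\<close> can be covered by \<open>m\<close> equal steps of length at most \<open>\<delta>\<close>.\<close>

lemma modulus_of_continuity_steps:
  assumes f: "f \<in> C_B" and "t \<ge> 0" "s \<ge> 0" and "\<bar>t - s\<bar> \<le> real m * \<delta>"
  shows "\<bar>f t - f s\<bar> \<le> real m * modulus_of_continuity f \<delta>"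
proof (cases "m = 0")
  case True
  then show ?thesis using assms by simp
next
  case False
  define p where "p i = s + real i / real m * (t - s)" for i
  have p_nonneg: "p i \<ge> 0" if "i \<le> m" for i
  proof -
    have "p i = (1 - real i / real m) * s + real i / real m * t"
      using False by (simp add: p_def field_simps)
    moreover have "real i / real m \<le> 1" using that False by simp
    ultimately show ?thesis using assms by simp
  qed
  have step: "\<bar>f (p (Suc i)) - f (p i)\<bar> \<le> modulus_of_continuity f \<delta>" if "i < m" for i
  proof (rule modulus_of_continuity_upper[OF f])
    have "p (Suc i) - p i = (t - s) / real m"
      by (simp add: p_def add_divide_distrib algebra_simps)
    then have "\<bar>p (Suc i) - p i\<bar> = \<bar>t - s\<bar> / real m" by simp
    also have "\<dots> \<le> \<delta>" using assms(4) False by (simp add: field_simps)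
    finally show "\<bar>p (Suc i) - p i\<bar> \<le> \<delta>" .
  qed (use that in \<open>auto intro!: p_nonneg\<close>)
  have "f t - f s = (\<Sum>i<m. f (p (Suc i)) - f (p i))"
    unfolding sum_lessThan_telescope[of "\<lambda>i. f (p i)" m] using False by (simp add: p_def)
  also have "\<bar>\<dots>\<bar> \<le> (\<Sum>i<m. \<bar>f (p (Suc i)) - f (p i)\<bar>)" by (rule sum_abs)
  also have "\<dots> \<le> real m * modulus_of_continuity f \<delta>"
    using sum_bounded_above[of "{..<m}" "\<lambda>i. \<bar>f (p (Suc i)) - f (p i)\<bar>"] step by simp
  finally show ?thesis .
qed

text \<open>
  Within distance \<open>\<delta>\<close> the constant term suffices; beyond it, the number of steps is at most
  \<open>1 + \<bar>t - s\<bar> / \<delta>\<close>, and \<open>\<bar>t - s\<bar> / \<delta> \<ge> 1\<close> may be replaced by its square.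
\<close>

lemma modulus_of_continuity_quadratic:
  assumes f: "f \<in> C_B" and "t \<ge> 0" "s \<ge> 0" and "\<delta> > 0"
  shows "\<bar>f t - f s\<bar> \<le> (1 + (t - s)\<^sup>2 / \<delta>\<^sup>2) * modulus_of_continuity f \<delta>"
proof -
  let ?\<omega> = "modulus_of_continuity f \<delta>"
  have \<omega>: "?\<omega> \<ge> 0" using modulus_of_continuity_nonneg[OF f] assms(4) by simp
  define q where "q = \<bar>t - s\<bar> / \<delta>"
  have q: "q \<ge> 0" "\<bar>t - s\<bar> = q * \<delta>" using assms(4) by (auto simp: q_def)
  have sq: "(t - s)\<^sup>2 / \<delta>\<^sup>2 = q\<^sup>2" by (simp add: q_def power_divide)
  define m where "m = (if q \<le> 1 then 1 else nat \<lceil>q\<rceil>)"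
  have m: "q \<le> real m" by (simp add: m_def)
  have "real m \<le> 1 + q\<^sup>2"
  proof (cases "q \<le> 1")
    case False
    then have "real m \<le> 1 + q" by (simp add: m_def) linarith
    moreover have "q \<le> q\<^sup>2" using False by (simp add: power2_eq_square)
    ultimately show ?thesis by linarith
  qed (simp add: m_def)
  have "\<bar>t - s\<bar> \<le> real m * \<delta>" using m q assms(4) by simp
  then have "\<bar>f t - f s\<bar> \<le> real m * ?\<omega>"
    using modulus_of_continuity_steps[OF f] assms by blast
  also have "\<dots> \<le> (1 + q\<^sup>2) * ?\<omega>"
    using \<open>real m \<le> 1 + q\<^sup>2\<close> \<omega> by (rule mult_right_mono)
  finally show ?thesis by (simp add: sq)
qed

section \<open>The Kantorovich operator\<close>

definition dunkl_cell :: "real \<Rightarrow> nat \<Rightarrow> nat \<Rightarrow> real set" where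
  "dunkl_cell \<mu> n k = {dunkl_node \<mu> k / real n .. (dunkl_node \<mu> k + 1) / real n}"

lemma dunkl_kantorovich_altdef:
  "dunkl_kantorovich \<mu> n f x =
     (\<Sum>k. (real n * r_shift n x) ^ k / dunkl_gamma \<mu> k * integral (dunkl_cell \<mu> n k) f)
       * (real n / dunkl_exp \<mu> (real n * r_shift n x))"
  by (simp add: dunkl_kantorovich_def dunkl_cell_def dunkl_node_def algebra_simps)

lemma dunkl_cell_nonneg:
  assumes "\<mu> \<ge> 0" "t \<in> dunkl_cell \<mu> n k"
  shows "t \<ge> 0"
proof -
  have "0 \<le> dunkl_node \<mu> k / real n"
    using dunkl_node_ge[OF assms(1), of k] by simp
  also have "\<dots> \<le> t" using assms(2) by (simp add: dunkl_cell_def)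
  finally show ?thesis .
qed

lemma has_integral_const_dunkl_cell:
  assumes "n \<ge> 1"
  shows "((\<lambda>_. c) has_integral c / real n) (dunkl_cell \<mu> n k)"
  using has_integral_const_real[of c "dunkl_node \<mu> k / real n" "(dunkl_node \<mu> k + 1) / real n"]
    assms by (simp add: dunkl_cell_def diff_divide_distrib[symmetric] divide_right_mono)

text \<open>
  With \<open>y = n x - 1/2\<close>, the midpoint of the cell differs from \<open>x\<close> by \<open>(h\<^sub>k - y) / n\<close>; the
  constant \<open>1/12\<close> is the variance of the uniform distribution on a unit interval.
\<close>

lemma has_integral_square_dunkl_cell:
  assumes "n \<ge> 1"
  shows "((\<lambda>t. (t - x)\<^sup>2) has_integral
           ((dunkl_node \<mu> k - real n * r_shift n x)\<^sup>2 + 1 / 12) / real n ^ 3) (dunkl_cell \<mu> n k)"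
proof -
  define h where "h = dunkl_node \<mu> k"
  define N where "N = real n"
  have N: "N > 0" using assms by (simp add: N_def)
  have "((\<lambda>t. (t - x)\<^sup>2) has_integral (((h + 1) / N - x) ^ 3 / 3 - (h / N - x) ^ 3 / 3))
          {h / N..(h + 1) / N}"
  proof (rule fundamental_theorem_of_calculus)
    show "h / N \<le> (h + 1) / N" using N by (simp add: divide_right_mono)
    show "((\<lambda>t. (t - x) ^ 3 / 3) has_vector_derivative (t - x)\<^sup>2)
            (at t within {h / N..(h + 1) / N})" for t
      unfolding has_real_derivative_iff_has_vector_derivative[symmetric]
      by (auto intro!: derivative_eq_intros)
  qed
  moreover have "((h + 1) / N - x) ^ 3 / 3 - (h / N - x) ^ 3 / 3
                 = ((h - N * (x - 1 / (2 * N)))\<^sup>2 + 1 / 12) / N ^ 3"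
  proof -
    have "(h + 1) / N - x = (h + 1 - N * x) / N" "h / N - x = (h - N * x) / N"
      "N * (x - 1 / (2 * N)) = N * x - 1 / 2"
      using N by (auto simp: field_simps)
    then show ?thesis
      using N by (simp add: power_divide diff_divide_distrib[symmetric])
        (simp add: power2_eq_square power3_eq_cube field_simps)
  qed
  ultimately show ?thesis
    by (simp add: dunkl_cell_def r_shift_def h_def N_def)
qed

lemma r_shift_nonneg:
  assumes "x \<ge> 1 / 2" "n \<ge> 1"
  shows "r_shift n x \<ge> 0"
proof -
  have "1 / (2 * real n) \<le> 1 / 2" using assms(2) by simp
  then show ?thesis using assms(1) by (simp add: r_shift_def)
qed

lemma dunkl_kantorovich_square_sums:
  fixes \<mu> x :: real and n :: nat
  assumes "\<mu> \<ge> 0" "n \<ge> 1"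
  defines "y \<equiv> real n * r_shift n x"
  shows "(\<lambda>k. y ^ k / dunkl_gamma \<mu> k * integral (dunkl_cell \<mu> n k) (\<lambda>t. (t - x)\<^sup>2)) sums
           ((y * (dunkl_exp \<mu> y + 2 * \<mu> * dunkl_exp \<mu> (- y)) + dunkl_exp \<mu> y / 12) / real n ^ 3)"
proof -
  have "(\<lambda>k. (y ^ k / dunkl_gamma \<mu> k * (dunkl_node \<mu> k - y)\<^sup>2 + y ^ k / dunkl_gamma \<mu> k / 12)
              / real n ^ 3) sums
          ((y * (dunkl_exp \<mu> y + 2 * \<mu> * dunkl_exp \<mu> (- y)) + dunkl_exp \<mu> y / 12) / real n ^ 3)"
    by (intro sums_add sums_divide dunkl_variance_sums dunkl_exp_sums assms(1))
  moreover have "integral (dunkl_cell \<mu> n k) (\<lambda>t. (t - x)\<^sup>2)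
                   = ((dunkl_node \<mu> k - y)\<^sup>2 + 1 / 12) / real n ^ 3" for k
    unfolding y_def by (rule integral_unique[OF has_integral_square_dunkl_cell[OF assms(2)]])
  ultimately show ?thesis by (simp add: ring_distribs)
qed

lemma dunkl_kantorovich_square:
  fixes \<mu> x :: real and n :: nat
  assumes "\<mu> \<ge> 0" "x \<ge> 1 / 2" "n \<ge> 1"
  defines "y \<equiv> real n * r_shift n x"
  shows "dunkl_kantorovich \<mu> n (\<lambda>t. (t - x)\<^sup>2) x =
           (y * (1 + 2 * \<mu> * (dunkl_exp \<mu> (- y) / dunkl_exp \<mu> y)) + 1 / 12) / (real n)\<^sup>2"
proof -
  have "dunkl_exp \<mu> y > 0"
    using assms r_shift_nonneg[OF assms(2,3)] by (intro dunkl_exp_pos) (auto simp: y_def)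
  then show ?thesis
    using sums_unique[OF dunkl_kantorovich_square_sums[OF assms(1,3), of x], symmetric] assms(3)
    by (simp add: dunkl_kantorovich_altdef y_def[symmetric] power2_eq_square power3_eq_cube
        field_simps)
qed

text \<open>
  The sign of \<open>e\<^sub>\<mu>(-y)\<close> cannot be read off its alternating series, but the closed form containing
  it is the variance of the weights, a sum of nonnegative terms; the term \<open>1/12\<close> then makes the
  second moment strictly positive.
\<close>

lemma dunkl_kantorovich_square_pos:
  assumes "\<mu> \<ge> 0" "x \<ge> 1 / 2" "n \<ge> 1"
  shows "dunkl_kantorovich \<mu> n (\<lambda>t. (t - x)\<^sup>2) x > 0"
proof -
  define y where "y = real n * r_shift n x"
  have y: "y \<ge> 0" using r_shift_nonneg[OF assms(2,3)] by (simp add: y_def)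
  have S: "dunkl_exp \<mu> y > 0" using dunkl_exp_pos[OF assms(1) y] .
  have "0 \<le> y ^ k / dunkl_gamma \<mu> k * (dunkl_node \<mu> k - y)\<^sup>2" for k
    using y dunkl_gamma_pos[OF assms(1), of k] by simp
  then have "0 \<le> y * (dunkl_exp \<mu> y + 2 * \<mu> * dunkl_exp \<mu> (- y))"
    using dunkl_variance_sums[OF assms(1), of y] by (rule sums_le[OF _ sums_zero])
  then have "0 \<le> y * (dunkl_exp \<mu> y + 2 * \<mu> * dunkl_exp \<mu> (- y)) / dunkl_exp \<mu> y"
    using S by simp
  also have "\<dots> = y * (1 + 2 * \<mu> * (dunkl_exp \<mu> (- y) / dunkl_exp \<mu> y))"
    using S by (simp add: field_simps)
  finally show ?thesis
    using dunkl_kantorovich_square[OF assms] assms(3) by (simp add: y_def[symmetric])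
qed

text \<open>
  Positivity and normalisation of the operator, in the form needed: a quadratic bound on the
  deviation of \<open>f\<close> from a constant survives averaging.  The series that defines the operator
  converges by comparison with the same bound.
\<close>

lemma dunkl_kantorovich_deviation_le:
  assumes "\<mu> \<ge> 0" "x \<ge> 1 / 2" "n \<ge> 1"
    and cont: "continuous_on {0..} f"
    and bound: "\<And>t. t \<ge> 0 \<Longrightarrow> \<bar>f t - c\<bar> \<le> p + q * (t - x)\<^sup>2"
  shows "\<bar>dunkl_kantorovich \<mu> n f x - c\<bar> \<le> p + q * dunkl_kantorovich \<mu> n (\<lambda>t. (t - x)\<^sup>2) x"
proof -
  define y where "y = real n * r_shift n x"
  define w where "w k = y ^ k / dunkl_gamma \<mu> k" for k
  define S where "S = dunkl_exp \<mu> y"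
  define I where "I k = integral (dunkl_cell \<mu> n k) f" for k
  define Q where "Q k = integral (dunkl_cell \<mu> n k) (\<lambda>t. (t - x)\<^sup>2)" for k
  have n: "real n > 0" using assms(3) by simp
  have y: "y \<ge> 0" using r_shift_nonneg[OF assms(2,3)] by (simp add: y_def)
  have S: "S > 0" using dunkl_exp_pos[OF assms(1) y] by (simp add: S_def)
  have w: "w k \<ge> 0" for k using y dunkl_gamma_pos[OF assms(1), of k] by (simp add: w_def)
  have w_sums: "w sums S" using dunkl_exp_sums[OF assms(1), of y] by (simp add: w_def[abs_def] S_def)

  have cell: "\<bar>I k - c / real n\<bar> \<le> p / real n + q * Q k" for k
  proof -
    have "f integrable_on dunkl_cell \<mu> n k"
      unfolding dunkl_cell_def
      by (rule integrable_continuous_real, rule continuous_on_subset[OF cont])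
        (use dunkl_cell_nonneg[OF assms(1), of _ n k] in \<open>auto simp: dunkl_cell_def\<close>)
    then have f: "((\<lambda>t. f t - c) has_integral (I k - c / real n)) (dunkl_cell \<mu> n k)"
      unfolding I_def
      by (intro has_integral_diff has_integral_const_dunkl_cell assms(3)) (rule integrable_integral)
    have "((\<lambda>t. (t - x)\<^sup>2) has_integral Q k) (dunkl_cell \<mu> n k)"
      unfolding Q_def using has_integral_square_dunkl_cell[OF assms(3)]
      by (intro integrable_integral) (rule has_integral_integrable)
    then have g: "((\<lambda>t. p + q * (t - x)\<^sup>2) has_integral (p / real n + q * Q k)) (dunkl_cell \<mu> n k)"
      by (intro has_integral_add has_integral_const_dunkl_cell assms(3) has_integral_mult_right)
    have "norm (integral (dunkl_cell \<mu> n k) (\<lambda>t. f t - c))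
            \<le> integral (dunkl_cell \<mu> n k) (\<lambda>t. p + q * (t - x)\<^sup>2)"
      using f g bound dunkl_cell_nonneg[OF assms(1)]
      by (intro integral_norm_bound_integral) (auto intro: has_integral_integrable)
    then show ?thesis using integral_unique[OF f] integral_unique[OF g] by simp
  qed

  have Q_sums: "(\<lambda>k. w k * Q k) sums (\<Sum>k. w k * Q k)"
    using dunkl_kantorovich_square_sums[OF assms(1,3), of x]
    by (simp add: w_def Q_def y_def summable_sums sums_summable)
  have "(\<lambda>k. p / real n * w k + q * (w k * Q k)) sums (p / real n * S + q * (\<Sum>k. w k * Q k))"
    by (intro sums_add sums_mult w_sums Q_sums)
  then have B_sums: "(\<lambda>k. w k * (p / real n + q * Q k)) sums
      (p / real n * S + q * (\<Sum>k. w k * Q k))"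
    by (simp add: algebra_simps)
  have le: "\<bar>w k * (I k - c / real n)\<bar> \<le> w k * (p / real n + q * Q k)" for k
    using cell[of k] w[of k] by (simp add: abs_mult mult_left_mono)
  have D_summable: "summable (\<lambda>k. \<bar>w k * (I k - c / real n)\<bar>)"
    by (rule summable_comparison_test'[OF sums_summable[OF B_sums], of 0])
      (simp only: real_norm_def abs_abs le)
  define D where "D = (\<Sum>k. w k * (I k - c / real n))"
  have D_sums: "(\<lambda>k. w k * (I k - c / real n)) sums D"
    unfolding D_def using summable_rabs_cancel[OF D_summable] by (rule summable_sums)
  have D_le: "\<bar>D\<bar> \<le> p / real n * S + q * (\<Sum>k. w k * Q k)"
  proof -
    have "\<bar>D\<bar> \<le> (\<Sum>k. \<bar>w k * (I k - c / real n)\<bar>)"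
      unfolding D_def by (rule summable_rabs[OF D_summable])
    also have "\<dots> \<le> p / real n * S + q * (\<Sum>k. w k * Q k)"
      by (rule sums_le[OF le summable_sums[OF D_summable] B_sums])
    finally show ?thesis .
  qed

  have "(\<lambda>k. w k * (I k - c / real n) + c / real n * w k) sums (D + c / real n * S)"
    by (intro sums_add sums_mult D_sums w_sums)
  then have "(\<lambda>k. w k * I k) sums (D + c / real n * S)"
    by (simp add: algebra_simps)
  then have "(\<Sum>k. w k * I k) = D + c / real n * S"
    by (rule sums_unique[symmetric])
  then have "dunkl_kantorovich \<mu> n f x = (D + c / real n * S) * (real n / S)"
    unfolding dunkl_kantorovich_altdef w_def I_def y_def[symmetric] S_def by (simp only:)
  then have "dunkl_kantorovich \<mu> n f x - c = D * (real n / S)"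
    using n S by (simp add: distrib_right add_divide_distrib)
  then have "\<bar>dunkl_kantorovich \<mu> n f x - c\<bar> = \<bar>D\<bar> * (real n / S)"
    using n S by (simp add: abs_mult)
  also have "\<dots> \<le> (p / real n * S + q * (\<Sum>k. w k * Q k)) * (real n / S)"
    using D_le n S by (intro mult_right_mono) auto
  also have "\<dots> = p + q * ((\<Sum>k. w k * Q k) * (real n / S))"
    using n S by (simp add: field_simps)
  also have "(\<Sum>k. w k * Q k) * (real n / S) = dunkl_kantorovich \<mu> n (\<lambda>t. (t - x)\<^sup>2) x"
    by (simp add: dunkl_kantorovich_altdef w_def Q_def y_def S_def)
  finally show ?thesis .
qed

theorem theorem4p1:
  fixes \<mu> x :: real and n :: nat and f :: "real \<Rightarrow> real"
  assumes "\<mu> \<ge> 0" and "f \<in> C_B" and "x \<ge> 1 / 2" and "n \<ge> 1"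
  shows "\<bar>dunkl_kantorovich \<mu> n f x - f x\<bar> \<le> 2 * modulus_of_continuity f (dunkl_delta \<mu> n x) \<and>
         dunkl_delta \<mu> n x =
           sqrt ((1 + 2 * \<mu> * (dunkl_exp \<mu> (- (real n * r_shift n x)) / dunkl_exp \<mu> (real n * r_shift n x)))
                   * (x / real n)
                 - 1 / (real n)\<^sup>2 *
                   (5 / 12 + \<mu> * (dunkl_exp \<mu> (- (real n * r_shift n x)) / dunkl_exp \<mu> (real n * r_shift n x))))"
proof
  let ?\<delta> = "dunkl_delta \<mu> n x"
  let ?\<omega> = "modulus_of_continuity f ?\<delta>"
  let ?V = "dunkl_kantorovich \<mu> n (\<lambda>t. (t - x)\<^sup>2) x"
  have V: "?V > 0" using dunkl_kantorovich_square_pos[OF assms(1,3,4)] .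
  have \<delta>: "?\<delta> > 0" "?\<delta>\<^sup>2 = ?V" using V by (auto simp: dunkl_delta_def)
  have "\<bar>f t - f x\<bar> \<le> ?\<omega> + ?\<omega> / ?V * (t - x)\<^sup>2" if "t \<ge> 0" for t
    using modulus_of_continuity_quadratic[OF assms(2) that, of x ?\<delta>] assms(3) \<delta>
    by (simp add: algebra_simps)
  then have "\<bar>dunkl_kantorovich \<mu> n f x - f x\<bar> \<le> ?\<omega> + ?\<omega> / ?V * ?V"
    using assms by (intro dunkl_kantorovich_deviation_le) (auto simp: C_B_def)
  then show "\<bar>dunkl_kantorovich \<mu> n f x - f x\<bar> \<le> 2 * ?\<omega>"
    using V by simp
next
  define E where "E = dunkl_exp \<mu> (- (real n * r_shift n x)) / dunkl_exp \<mu> (real n * r_shift n x)"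
  have y: "real n * r_shift n x = real n * x - 1 / 2"
    using assms(4) by (simp add: r_shift_def field_simps)
  have "((real n * r_shift n x) * (1 + 2 * \<mu> * E) + 1 / 12) / (real n)\<^sup>2
        = (1 + 2 * \<mu> * E) * (x / real n) - 1 / (real n)\<^sup>2 * (5 / 12 + \<mu> * E)"
    unfolding y using assms(4) by (simp add: power2_eq_square field_simps)
  then show "dunkl_delta \<mu> n x =
           sqrt ((1 + 2 * \<mu> * (dunkl_exp \<mu> (- (real n * r_shift n x)) / dunkl_exp \<mu> (real n * r_shift n x)))
                   * (x / real n)
                 - 1 / (real n)\<^sup>2 *
                   (5 / 12 + \<mu> * (dunkl_exp \<mu> (- (real n * r_shift n x)) / dunkl_exp \<mu> (real n * r_shift n x))))"
    using dunkl_kantorovich_square[OF assms(1,3,4)]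
    by (simp add: dunkl_delta_def E_def)
qed

end
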